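(* If $G$ is a $k$-tree, then the number of clique trees of $G$ equals the number of spanning trees of the reduced clique graph $C_r(G)$.
   Context: A $k$-tree: $K_{k+1}$ is a $k$-tree, and adding to a $k$-tree a new vertex adjacent exactly to the vertices of a $k$-clique gives a $k$-tree. The clique-intersection graph of a connected chordal graph $G$ has the maximal cliques of $G$ as vertices, edges between intersecting maximal cliques, weighted by $|Q\cap Q'|$; a clique tree of $G$ is a maximum-weight spanning tree of it. Maximal cliques $Q,Q'$ form a separating pair if $Q\cap Q'\ne\emptyset$ and every path in $G$ from $Q\setminus Q'$ to $Q'\setminus Q$ contains a vertex of $Q\cap Q'$; the reduced clique graph $C_r(G)$ has the maximal cliques of $G$ as vertices, two adjacent iff they form a separating pair. *)

theory Defs
  imports Main
begin

text \<open>
  Undirected graphs with edges as two-element vertex sets. (The notion of forest in the AFP entry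
  Graph_Theory excludes directed cycles, hence it is not the undirected one on symmetric digraphs.)
\<close>

record 'a ugraph =
  uverts :: "'a set"
  uedges :: "'a set set"

definition simple_ugraph :: "'a ugraph \<Rightarrow> bool" where
  "simple_ugraph G \<longleftrightarrow> finite (uverts G) \<and> (\<forall>e\<in>uedges G. e \<subseteq> uverts G \<and> card e = 2)"

definition upath :: "'a ugraph \<Rightarrow> 'a list \<Rightarrow> bool" where
  "upath G p \<longleftrightarrow> p \<noteq> [] \<and> set p \<subseteq> uverts G \<and> distinct p \<and>
     successively (\<lambda>u v. {u, v} \<in> uedges G) p"

text \<open>A cycle is given by the list of its vertices, without repeating the first one at the end.\<close>

definition ucycle :: "'a ugraph \<Rightarrow> 'a list \<Rightarrow> bool" where
  "ucycle G p \<longleftrightarrow> upath G p \<and> 3 \<le> length p \<and> {last p, hd p} \<in> uedges G"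

definition uconnected :: "'a ugraph \<Rightarrow> bool" where
  "uconnected G \<longleftrightarrow> uverts G \<noteq> {} \<and>
     (\<forall>u\<in>uverts G. \<forall>v\<in>uverts G. \<exists>p. upath G p \<and> hd p = u \<and> last p = v)"

definition utree :: "'a ugraph \<Rightarrow> bool" where
  "utree T \<longleftrightarrow> simple_ugraph T \<and> uconnected T \<and> (\<nexists>p. ucycle T p)"

definition uspanning_tree :: "'a ugraph \<Rightarrow> 'a ugraph \<Rightarrow> bool" where
  "uspanning_tree G T \<longleftrightarrow> utree T \<and> uverts T = uverts G \<and> uedges T \<subseteq> uedges G"

definition clique :: "'a ugraph \<Rightarrow> 'a set \<Rightarrow> bool" where
  "clique G Q \<longleftrightarrow> Q \<subseteq> uverts G \<and> (\<forall>u\<in>Q. \<forall>v\<in>Q. u \<noteq> v \<longrightarrow> {u, v} \<in> uedges G)"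

definition maximal_clique :: "'a ugraph \<Rightarrow> 'a set \<Rightarrow> bool" where
  "maximal_clique G Q \<longleftrightarrow> clique G Q \<and> (\<forall>Q'. clique G Q' \<and> Q \<subseteq> Q' \<longrightarrow> Q' = Q)"

inductive k_tree :: "nat \<Rightarrow> 'a ugraph \<Rightarrow> bool" for k :: nat where
  complete: "card V = k + 1 \<Longrightarrow> k_tree k \<lparr>uverts = V, uedges = {e. e \<subseteq> V \<and> card e = 2}\<rparr>"
| add_vertex: "k_tree k G \<Longrightarrow> v \<notin> uverts G \<Longrightarrow> clique G Q \<Longrightarrow> card Q = k \<Longrightarrow>
    k_tree k \<lparr>uverts = insert v (uverts G), uedges = uedges G \<union> {{v, u} | u. u \<in> Q}\<rparr>"

definition clique_intersection_graph :: "'a ugraph \<Rightarrow> 'a set ugraph" where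
  "clique_intersection_graph G = \<lparr>uverts = {Q. maximal_clique G Q},
     uedges = {{Q, Q'} | Q Q'. maximal_clique G Q \<and> maximal_clique G Q' \<and> Q \<noteq> Q' \<and>
                 Q \<inter> Q' \<noteq> {}}\<rparr>"

text \<open>The edge \<open>{Q, Q'}\<close> has weight \<open>card (\<Inter>{Q, Q'}) = card (Q \<inter> Q')\<close>.\<close>

definition clique_weight :: "'a set ugraph \<Rightarrow> nat" where
  "clique_weight T = (\<Sum>e\<in>uedges T. card (\<Inter>e))"

definition clique_tree :: "'a ugraph \<Rightarrow> 'a set ugraph \<Rightarrow> bool" where
  "clique_tree G T \<longleftrightarrow> uspanning_tree (clique_intersection_graph G) T \<and>
     (\<forall>T'. uspanning_tree (clique_intersection_graph G) T' \<longrightarrow>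
        clique_weight T' \<le> clique_weight T)"

definition separating_pair :: "'a ugraph \<Rightarrow> 'a set \<Rightarrow> 'a set \<Rightarrow> bool" where
  "separating_pair G Q Q' \<longleftrightarrow> maximal_clique G Q \<and> maximal_clique G Q' \<and> Q \<inter> Q' \<noteq> {} \<and>
     (\<forall>p. upath G p \<and> hd p \<in> Q - Q' \<and> last p \<in> Q' - Q \<longrightarrow> set p \<inter> (Q \<inter> Q') \<noteq> {})"

text \<open>Distinctness is explicit because \<^term>\<open>separating_pair G Q Q\<close> holds vacuously.\<close>

definition reduced_clique_graph :: "'a ugraph \<Rightarrow> 'a set ugraph" where
  "reduced_clique_graph G = \<lparr>uverts = {Q. maximal_clique G Q},
     uedges = {{Q, Q'} | Q Q'. Q \<noteq> Q' \<and> separating_pair G Q Q'}\<rparr>"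

lemma k_tree_simple_ugraph: "k_tree k G \<Longrightarrow> simple_ugraph G"
proof (induction rule: k_tree.induct)
  case (complete V)
  then have "finite V" by (metis card.infinite add_is_0 one_neq_zero)
  then show ?case by (auto simp: simple_ugraph_def)
next
  case (add_vertex G v Q)
  then have "card {v, u} = 2" if "u \<in> Q" for u
    using that by (subst card_2_iff) (metis clique_def subsetD)
  with add_vertex show ?case by (auto simp: simple_ugraph_def clique_def)
qed

end

theory Submission
  imports Defs
begin

text \<open>
  All maximal cliques of a \<open>k\<close>-tree have \<open>k + 1\<close> vertices, and two of them form a separating pair
  iff they meet in \<open>k\<close> vertices, the largest possible number; this is shown along the construction
  of the \<open>k\<close>-tree. The construction also yields a spanning tree of the clique-intersection graph all
  of whose edges have weight \<open>k\<close>. As all spanning trees have equally many edges, the clique trees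
  are exactly the spanning trees using only edges of weight \<open>k\<close>, i.e. those of the reduced clique
  graph. (For \<open>k = 0\<close> neither graph has edges.)
\<close>

section \<open>Trees\<close>

lemma upath_tl: "upath G (x # y # p) \<Longrightarrow> upath G (y # p)"
  by (auto simp: upath_def)

lemma upath_prefix: "upath G (a @ x # b) \<Longrightarrow> upath G (a @ [x])"
  by (auto simp: upath_def successively_append_iff)

lemma upath_rev: "upath G (rev p) \<longleftrightarrow> upath G p"
  by (simp add: upath_def insert_commute)

lemma upath_mono:
  "upath G p \<Longrightarrow> uverts G \<subseteq> uverts H \<Longrightarrow> uedges G \<subseteq> uedges H \<Longrightarrow> upath H p"
  unfolding upath_def by (auto elim!: successively_mono)

lemma finite_uedges: "simple_ugraph G \<Longrightarrow> finite (uedges G)"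
  unfolding simple_ugraph_def by (meson PowI finite_Pow_iff finite_subset subsetI)

text \<open>If one endpoint lies on the path that starts at the other, then that path and the edge
  close up to a cycle unless the edge is the first step. Otherwise the two paths first meet in a
  third vertex and form a cycle with the edge. Applied to paths towards a root, this makes every
  edge lead from some vertex to its parent.\<close>

lemma acyclic_edge_on_path:
  assumes acyc: "\<nexists>p. ucycle T p"
    and e: "{u, v} \<in> uedges T" "u \<noteq> v"
    and p: "upath T p" "hd p = u" and q: "upath T q" "hd q = v" and pq: "last p = last q"
  shows "(\<exists>p'. p = u # v # p') \<or> (\<exists>q'. q = v # u # q')"
proof -
  have direct: "\<exists>p'. p = u # v # p'"
    if uv: "{u, v} \<in> uedges T" "u \<noteq> v" and p: "upath T p" "hd p = u" "v \<in> set p" for u v p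
  proof -
    obtain a b where ab: "p = a @ v # b" using p(3) by (meson split_list)
    obtain a' where a': "a = u # a'" using uv p ab by (cases a) auto
    have "a' = []"
    proof (rule ccontr)
      assume "a' \<noteq> []"
      moreover have "upath T (a @ [v])" using p(1) unfolding ab by (rule upath_prefix)
      ultimately have "ucycle T (a @ [v])"
        using uv(1) by (cases a') (auto simp: ucycle_def a' insert_commute)
      then show False using acyc by blast
    qed
    with ab a' show ?thesis by simp
  qed
  show ?thesis
  proof (cases "v \<in> set p \<or> u \<in> set q")
    case True
    then show ?thesis using direct[of u v p] direct[of v u q] e p q by (auto simp: insert_commute)
  next
    case False
    have "last p \<in> set p" "last q \<in> set q" using p(1) q(1) by (simp_all add: upath_def)
    then have "\<exists>x\<in>set p. x \<in> set q" using pq by auto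
    \<comment> \<open>\<open>x\<close> is the first vertex of \<open>p\<close> on \<open>q\<close>,
      so the parts of \<open>p\<close> and \<open>q\<close> before \<open>x\<close> are
      disjoint.\<close>
    then obtain a x b where a: "p = a @ x # b" "x \<in> set q" "\<forall>y\<in>set a. y \<notin> set q"
      using split_list_first_prop[of p "\<lambda>x. x \<in> set q"] by blast
    obtain c d where c: "q = c @ x # d" using a(2) by (meson split_list)
    obtain a' where a': "a = u # a'" using a p False by (cases a) auto
    obtain c' where c': "c = v # c'" using c q a False by (cases c) auto
    \<comment> \<open>From \<open>u\<close> along \<open>p\<close> to \<open>x\<close>, then
      backwards along \<open>q\<close> to \<open>v\<close>; the edge closes this path.\<close>
    have "upath T ((a @ [x]) @ rev c)"
    proof -
      have "upath T (c @ [x])" using q(1) unfolding c by (rule upath_prefix)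
      then have "upath T (x # rev c)" using upath_rev[of T "c @ [x]"] by simp
      moreover have "upath T (a @ [x])" using p(1) unfolding a(1) by (rule upath_prefix)
      moreover have "set a \<inter> set c = {}" "x \<notin> set c" "x \<notin> set a" using a(3) q(1) p(1)
        unfolding c a(1) upath_def by auto
      ultimately show ?thesis
        by (auto simp: upath_def successively_append_iff successively_Cons)
    qed
    then have "ucycle T ((a @ [x]) @ rev c)"
      using e by (simp add: ucycle_def a' c' insert_commute)
    then show ?thesis using acyc by blast
  qed
qed

text \<open>Fix a root \<open>r\<close>. Sending every other vertex to the first edge of a shortest
  path to \<open>r\<close> is a bijection onto the edges. The equality gives all trees on the same
  vertices equally many edges, so a bound on each edge weight bounds all of them by the same
  total.\<close>

lemma card_uedges_utree:
  assumes "utree T"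
  shows "Suc (card (uedges T)) = card (uverts T)"
proof -
  let ?V = "uverts T"
  have simple: "simple_ugraph T" and conn: "uconnected T" and acyc: "\<nexists>p. ucycle T p"
    using assms by (auto simp: utree_def)
  obtain r where r: "r \<in> ?V" using conn by (auto simp: uconnected_def)
  have "\<exists>p. (upath T p \<and> hd p = v \<and> last p = r) \<and>
      (\<forall>q. upath T q \<and> hd q = v \<and> last q = r \<longrightarrow> length p \<le> length q)" if v: "v \<in> ?V" for v
  proof -
    obtain p where "upath T p \<and> hd p = v \<and> last p = r"
      using conn r v unfolding uconnected_def by meson
    then show ?thesis
      by (rule ex_has_least_nat[of "\<lambda>p. upath T p \<and> hd p = v \<and> last p = r" p length])
  qed
  then obtain P where P: "\<And>v. v \<in> ?V \<Longrightarrow> upath T (P v)" "\<And>v. v \<in> ?V \<Longrightarrow> hd (P v) = v"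
      "\<And>v. v \<in> ?V \<Longrightarrow> last (P v) = r"
    and P_min: "\<And>v q. v \<in> ?V \<Longrightarrow> upath T q \<Longrightarrow> hd q = v \<Longrightarrow> last q = r \<Longrightarrow> length (P v) \<le> length q"
    by (metis (mono_tags))
  \<comment> \<open>Meaningful only for \<open>v \<noteq> r\<close>: the shortest path
    \<open>P r\<close> has no second vertex.\<close>
  define parent where "parent v = hd (tl (P v))" for v
  have P_eq: "\<exists>p. P v = v # parent v # p" if "v \<in> ?V - {r}" for v
  proof -
    have "P v \<noteq> []" "hd (P v) = v" "last (P v) = r" "v \<noteq> r"
      using P[of v] that by (auto simp: upath_def)
    then show ?thesis unfolding parent_def
      by (cases "P v"; cases "tl (P v)") auto
  qed
  have P_less: "length (P (parent v)) < length (P v)" if v: "v \<in> ?V - {r}" for v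
  proof -
    obtain p where p: "P v = v # parent v # p" using P_eq[OF v] by blast
    then have "upath T (parent v # p)" "last (parent v # p) = r"
      using P[of v] v upath_tl[of T v "parent v" p] by auto
    then show ?thesis using P_min[of "parent v" "parent v # p"] p by (simp add: upath_def)
  qed
  have "bij_betw (\<lambda>v. {v, parent v}) (?V - {r}) (uedges T)"
  proof (rule bij_betw_imageI)
    show "inj_on (\<lambda>v. {v, parent v}) (?V - {r})"
    proof (rule inj_onI)
      fix v w assume vw: "v \<in> ?V - {r}" "w \<in> ?V - {r}" "{v, parent v} = {w, parent w}"
      \<comment> \<open>In the second case each of the two vertices would have a strictly shorter
        path to the root than the other.\<close>
      then have "v = w \<or> (parent v = w \<and> parent w = v)" by (auto simp: doubleton_eq_iff)
      then show "v = w" using P_less[OF vw(1)] P_less[OF vw(2)] by auto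
    qed
    show "(\<lambda>v. {v, parent v}) ` (?V - {r}) = uedges T"
    proof (intro equalityI subsetI)
      fix e assume "e \<in> (\<lambda>v. {v, parent v}) ` (?V - {r})"
      then obtain v where v: "v \<in> ?V - {r}" "e = {v, parent v}" by blast
      obtain p where p: "P v = v # parent v # p" using P_eq[OF v(1)] by blast
      then show "e \<in> uedges T" using P(1)[of v] v by (auto simp: upath_def)
    next
      fix e assume e: "e \<in> uedges T"
      then obtain u v where uv: "e = {u, v}" "u \<noteq> v"
        using simple unfolding simple_ugraph_def by (meson card_2_iff)
      then have V: "u \<in> ?V" "v \<in> ?V" using e simple by (auto simp: simple_ugraph_def)
      have *: "{x, y} \<in> (\<lambda>v. {v, parent v}) ` (?V - {r})" if "P x = x # y # p" "x \<in> ?V" for x y p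
      proof -
        have "x \<noteq> r" "parent x = y"
          using that P(1)[of x] P(3)[of x] by (auto simp: parent_def upath_def split: if_splits)
        then show ?thesis using that(2) by blast
      qed
      \<comment> \<open>Both chosen paths end in \<open>r\<close>, so acyclicity makes the edge the
        first step of one of them.\<close>
      have "(\<exists>p'. P u = u # v # p') \<or> (\<exists>q'. P v = v # u # q')"
        using acyclic_edge_on_path[OF acyc _ uv(2)] e uv P V by metis
      then show "e \<in> (\<lambda>v. {v, parent v}) ` (?V - {r})"
        using *[of u v] *[of v u] uv(1) V by (metis insert_commute)
    qed
  qed
  then have "card (uedges T) = card (?V - {r})" by (simp add: bij_betw_same_card)
  moreover have "finite ?V" using simple by (simp add: simple_ugraph_def)
  ultimately show ?thesis using r by (metis card.remove)
qed

section \<open>Building trees leaf by leaf\<close>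

lemma utree_singleton: "utree \<lparr>uverts = {x}, uedges = {}\<rparr>"
proof -
  have "upath \<lparr>uverts = {x}, uedges = {}\<rparr> [x]" by (simp add: upath_def)
  then have "uconnected \<lparr>uverts = {x}, uedges = {}\<rparr>"
    unfolding uconnected_def by (auto intro!: exI[of _ "[x]"])
  then show ?thesis by (simp add: utree_def simple_ugraph_def ucycle_def)
qed

text \<open>On a cycle through \<open>w\<close> both neighbours of \<open>w\<close> would have to be
  \<open>x\<close>, although a cycle repeats no vertex. A cycle avoiding \<open>w\<close> already
  lies in \<open>T\<close>.\<close>

lemma utree_add_leaf:
  assumes T: "utree T" and x: "x \<in> uverts T" and w: "w \<notin> uverts T"
  shows "utree \<lparr>uverts = insert w (uverts T), uedges = insert {w, x} (uedges T)\<rparr>" (is "utree ?T'")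
proof -
  have simple: "simple_ugraph T" and conn: "uconnected T" and acyc: "\<nexists>p. ucycle T p"
    using T by (auto simp: utree_def)
  have simple': "simple_ugraph ?T'"
    using simple x w by (auto simp: simple_ugraph_def card_insert_if)
  have up: "upath ?T' p" if "upath T p" for p
    using that by (rule upath_mono) auto
  have leaf: "\<exists>p. upath ?T' p \<and> hd p = w \<and> last p = v" if v: "v \<in> uverts T" for v
  proof -
    obtain p where p: "upath T p" "hd p = x" "last p = v"
      using conn x v unfolding uconnected_def by blast
    then have "upath ?T' (w # p)" using up[OF p(1)] w p(1)
      by (auto simp: upath_def successively_Cons)
    then show ?thesis using p by (intro exI[of _ "w # p"]) (auto simp: upath_def)
  qed
  have conn': "uconnected ?T'"
    unfolding uconnected_def
  proof (intro conjI ballI)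
    fix u v assume uv: "u \<in> uverts ?T'" "v \<in> uverts ?T'"
    consider "u \<in> uverts T" "v \<in> uverts T" | "u = w" "v = w" | "u = w" "v \<in> uverts T"
      | "v = w" "u \<in> uverts T" using uv by auto
    then show "\<exists>p. upath ?T' p \<and> hd p = u \<and> last p = v"
    proof cases
      case 1
      then show ?thesis using conn up unfolding uconnected_def by blast
    next
      case 2
      then show ?thesis by (intro exI[of _ "[w]"]) (simp add: upath_def)
    next
      case 3
      then show ?thesis using leaf by blast
    next
      case 4
      then obtain p where "upath ?T' p" "hd p = w" "last p = u" using leaf by blast
      then show ?thesis using 4
        by (intro exI[of _ "rev p"]) (auto simp: upath_rev hd_rev last_rev)
    qed
  qed simp
  have nbr: "y = x" if "{w, y} \<in> uedges ?T' \<or> {y, w} \<in> uedges ?T'" for y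
    using that w simple by (auto simp: simple_ugraph_def doubleton_eq_iff)
  have "False" if p: "ucycle ?T' p" for p
  proof (cases "w \<in> set p")
    case False
    have e: "{a, b} \<in> uedges T" if "{a, b} \<in> uedges ?T'" "a \<in> set p" "b \<in> set p" for a b
      using that False by (auto simp: doubleton_eq_iff)
    have "successively (\<lambda>u v. {u, v} \<in> uedges T) p"
      using p e unfolding ucycle_def upath_def by (auto elim!: successively_mono)
    moreover have "{last p, hd p} \<in> uedges T"
      using p by (intro e) (auto simp: ucycle_def upath_def)
    ultimately have "ucycle T p"
      using p False by (auto simp: ucycle_def upath_def)
    then show False using acyc by blast
  next
    case True
    then obtain a b where ab: "p = a @ w # b" by (meson split_list)
    have s: "successively (\<lambda>u v. {u, v} \<in> uedges ?T') (a @ w # b)" and d: "distinct (a @ w # b)"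
      and l: "3 \<le> length (a @ w # b)" and c: "{last (a @ w # b), hd (a @ w # b)} \<in> uedges ?T'"
      using p by (auto simp: ucycle_def upath_def ab)
    have la: "last a = x" if "a \<noteq> []"
      using s that nbr[of "last a"] by (auto simp: successively_append_iff)
    have hb: "hd b = x" if "b \<noteq> []"
      using s that nbr[of "hd b"] by (auto simp: successively_append_iff successively_Cons)
    \<comment> \<open>If \<open>w\<close> is the first or last vertex of the list, one of its two
      neighbours on the cycle comes from the closing edge.\<close>
    show False
    proof (cases "a = []")
      case True
      then have b: "b \<noteq> []" "length b \<ge> 2" using l by auto
      then have "last b = x" using c True nbr by auto
      then show False using hb b d
        by (cases b) (auto split: if_splits)
    next
      case a: False
      show False
      proof (cases "b = []")
        case True
        then have "hd a = x" "length a \<ge> 2" using l c a nbr by auto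
        then show False using la[OF a] a d by (cases a) (auto split: if_splits)
      next
        case False
        then show False using la[OF a] hb[OF False] a d
          by (metis disjoint_iff distinct_append last_in_set list.set_sel(1) list.set_intros(2))
      qed
    qed
  qed
  then show ?thesis using simple' conn' unfolding utree_def by blast
qed

section \<open>Separation\<close>

text \<open>The reflexive transitive closure is reachability by walks after deleting
  \<open>X\<close>; walks can be concatenated without restoring distinctness. The closure also
  relates every element to itself, even one in \<open>X\<close>.\<close>

definition adj_avoiding :: "'a ugraph \<Rightarrow> 'a set \<Rightarrow> 'a \<Rightarrow> 'a \<Rightarrow> bool" where
  "adj_avoiding G X u v \<longleftrightarrow> {u, v} \<in> uedges G \<and> u \<notin> X \<and> v \<notin> X"

lemma adj_avoiding_sym: "adj_avoiding G X u v \<Longrightarrow> adj_avoiding G X v u"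
  by (simp add: adj_avoiding_def insert_commute)

lemma rtranclp_adj_avoiding_sym: "(adj_avoiding G X)\<^sup>*\<^sup>* u v \<Longrightarrow> (adj_avoiding G X)\<^sup>*\<^sup>* v u"
  by (induction rule: rtranclp_induct) (auto intro: adj_avoiding_sym converse_rtranclp_into_rtranclp)

lemma rtranclp_adj_avoiding_mono:
  assumes "(adj_avoiding G X)\<^sup>*\<^sup>* u v" "uedges G \<subseteq> uedges H" "Y \<subseteq> X"
  shows "(adj_avoiding H Y)\<^sup>*\<^sup>* u v"
proof -
  have "adj_avoiding G X \<le> adj_avoiding H Y" using assms(2,3) by (auto simp: adj_avoiding_def)
  then show ?thesis using assms(1) rtranclp_mono by blast
qed

lemma upath_imp_rtranclp_adj_avoiding:
  "upath G p \<Longrightarrow> set p \<inter> X = {} \<Longrightarrow> (adj_avoiding G X)\<^sup>*\<^sup>* (hd p) (last p)"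
proof (induction p)
  case Nil
  then show ?case by (simp add: upath_def)
next
  case (Cons x p)
  show ?case
  proof (cases p)
    case Nil
    then show ?thesis by simp
  next
    case (Cons y q)
    then have "adj_avoiding G X x y" using Cons.prems by (auto simp: adj_avoiding_def upath_def)
    moreover have "(adj_avoiding G X)\<^sup>*\<^sup>* (hd p) (last p)"
      using Cons.IH Cons.prems upath_tl[of G x y q] Cons by auto
    ultimately show ?thesis using Cons by (simp add: converse_rtranclp_into_rtranclp)
  qed
qed

text \<open>The path grows edge by edge and is cut back whenever the new vertex is already on it.
  The condition on \<open>u\<close> takes care of the empty walk.\<close>

lemma rtranclp_adj_avoiding_imp_upath:
  assumes "simple_ugraph G" "(adj_avoiding G X)\<^sup>*\<^sup>* u v" "u \<in> uverts G - X"
  shows "\<exists>p. upath G p \<and> set p \<inter> X = {} \<and> hd p = u \<and> last p = v"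
  using assms(2)
proof (induction rule: rtranclp_induct)
  case base
  show ?case using assms(3) by (intro exI[of _ "[u]"]) (auto simp: upath_def)
next
  case (step y z)
  then obtain p where p: "upath G p" "set p \<inter> X = {}" "hd p = u" "last p = y" by blast
  have z: "{y, z} \<in> uedges G" "z \<notin> X" "z \<in> uverts G"
    using step assms(1) by (auto simp: adj_avoiding_def simple_ugraph_def)
  show ?case
  proof (cases "z \<in> set p")
    case True
    then obtain a b where ab: "p = a @ z # b" by (meson split_list)
    have "upath G (a @ [z])" using p(1) unfolding ab by (rule upath_prefix)
    moreover have "hd (a @ [z]) = u" using p(3) ab by (cases a) auto
    ultimately show ?thesis using p(2) ab by (intro exI[of _ "a @ [z]"]) auto
  next
    case False
    then have "upath G (p @ [z])" using p z
      by (auto simp: upath_def successively_append_iff)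
    moreover have "hd (p @ [z]) = u" using p by (auto simp: upath_def)
    ultimately show ?thesis using p z by (intro exI[of _ "p @ [z]"]) auto
  qed
qed

text \<open>The failure of the separation condition, with reachability in place of paths.
  Nonemptiness of the intersection is left to the lemmas that need it.\<close>

definition linked :: "'a ugraph \<Rightarrow> 'a set \<Rightarrow> 'a set \<Rightarrow> bool" where
  "linked G Q Q' \<longleftrightarrow> (\<exists>u\<in>Q - Q'. \<exists>v\<in>Q' - Q. (adj_avoiding G (Q \<inter> Q'))\<^sup>*\<^sup>* u v)"

lemma linked_sym: "linked G Q Q' \<longleftrightarrow> linked G Q' Q"
  unfolding linked_def by (metis Int_commute rtranclp_adj_avoiding_sym)

lemma separating_pair_iff_not_linked:
  assumes "simple_ugraph G" "maximal_clique G Q" "maximal_clique G Q'" "Q \<inter> Q' \<noteq> {}"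
  shows "separating_pair G Q Q' \<longleftrightarrow> \<not> linked G Q Q'"
proof
  assume s: "separating_pair G Q Q'"
  show "\<not> linked G Q Q'"
  proof
    assume "linked G Q Q'"
    then obtain u v where uv: "u \<in> Q - Q'" "v \<in> Q' - Q" "(adj_avoiding G (Q \<inter> Q'))\<^sup>*\<^sup>* u v"
      by (auto simp: linked_def)
    then have "u \<in> uverts G - Q \<inter> Q'"
      using assms(2) by (auto simp: maximal_clique_def clique_def)
    with rtranclp_adj_avoiding_imp_upath[OF assms(1) uv(3)] s uv(1,2) show False
      by (auto simp: separating_pair_def)
  qed
next
  assume "\<not> linked G Q Q'"
  then show "separating_pair G Q Q'"
    using assms upath_imp_rtranclp_adj_avoiding unfolding separating_pair_def linked_def by metis
qed

section \<open>Attaching a vertex to a clique\<close>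

text \<open>The graph built by the rule \<open>add_vertex\<close>. The new vertex is simplicial once
  \<open>S\<close> is a clique, which the lemmas assume where it matters.\<close>

definition add_simplicial :: "'a ugraph \<Rightarrow> 'a \<Rightarrow> 'a set \<Rightarrow> 'a ugraph" where
  "add_simplicial G v S = \<lparr>uverts = insert v (uverts G), uedges = uedges G \<union> {{v, u} | u. u \<in> S}\<rparr>"

lemma edge_add_simplicial_iff:
  assumes "simple_ugraph G" "v \<notin> uverts G" "v \<notin> S" "a \<noteq> b"
  shows "{a, b} \<in> uedges (add_simplicial G v S) \<longleftrightarrow>
    (a \<noteq> v \<and> b \<noteq> v \<and> {a, b} \<in> uedges G) \<or> (a = v \<and> b \<in> S) \<or> (b = v \<and> a \<in> S)"
  using assms by (auto simp: add_simplicial_def simple_ugraph_def doubleton_eq_iff)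

text \<open>A clique through \<open>v\<close> is confined to \<open>v\<close> and its neighbours,
  which are the vertices of the clique \<open>S\<close>; a clique avoiding \<open>v\<close> uses old
  edges only.\<close>

lemma clique_add_simplicial_iff:
  assumes "simple_ugraph G" "v \<notin> uverts G" "clique G S"
  shows "clique (add_simplicial G v S) C \<longleftrightarrow> (if v \<in> C then C \<subseteq> insert v S else clique G C)"
proof -
  have vS: "v \<notin> S" using assms(2,3) by (auto simp: clique_def)
  note edge = edge_add_simplicial_iff[OF assms(1,2) vS]
  have V: "uverts (add_simplicial G v S) = insert v (uverts G)" by (simp add: add_simplicial_def)
  show ?thesis
  proof (cases "v \<in> C")
    case True
    have "clique (add_simplicial G v S) C" if "C \<subseteq> insert v S"
      unfolding clique_def V
    proof (intro conjI ballI impI)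
      show "C \<subseteq> insert v (uverts G)" using that assms(3) by (auto simp: clique_def)
      fix a b assume ab: "a \<in> C" "b \<in> C" "a \<noteq> b"
      then have "a = v \<and> b \<in> S \<or> b = v \<and> a \<in> S \<or> a \<in> S \<and> b \<in> S" using that by auto
      then show "{a, b} \<in> uedges (add_simplicial G v S)"
        using ab(3) vS assms(3) by (auto simp: edge clique_def)
    qed
    moreover have "C \<subseteq> insert v S" if "clique (add_simplicial G v S) C"
    proof
      fix a assume "a \<in> C"
      then have "a \<noteq> v \<Longrightarrow> {v, a} \<in> uedges (add_simplicial G v S)"
        using that True by (auto simp: clique_def)
      then show "a \<in> insert v S" using edge[of v a] by auto
    qed
    ultimately show ?thesis using True by auto
  next
    case False
    then have "a \<in> C \<Longrightarrow> b \<in> C \<Longrightarrow> a \<noteq> b \<Longrightarrow>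
        {a, b} \<in> uedges (add_simplicial G v S) \<longleftrightarrow> {a, b} \<in> uedges G" for a b
      using edge[of a b] by auto
    then show ?thesis using False unfolding clique_def V by auto
  qed
qed

text \<open>An old maximal clique could only be absorbed by a clique through \<open>v\<close>. It
  would then lie in \<open>S\<close> and hence equal \<open>S\<close>, which is excluded because
  \<open>S\<close> is not maximal.\<close>

lemma maximal_clique_add_simplicial_iff:
  assumes G: "simple_ugraph G" "v \<notin> uverts G" "clique G S" and S: "\<not> maximal_clique G S"
  shows "maximal_clique (add_simplicial G v S) C \<longleftrightarrow> C = insert v S \<or> maximal_clique G C"
proof -
  have v: "v \<notin> D" if "clique G D" for D using that G(2) by (auto simp: clique_def)
  note iff = clique_add_simplicial_iff[OF G]
  have 1: "maximal_clique (add_simplicial G v S) (insert v S)"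
    unfolding maximal_clique_def iff by auto
  have 2: "maximal_clique (add_simplicial G v S) C" if C: "maximal_clique G C"
    unfolding maximal_clique_def
  proof (intro conjI allI impI)
    have "clique G C" using C by (simp add: maximal_clique_def)
    then show "clique (add_simplicial G v S) C" using v iff by simp
    fix D assume D: "clique (add_simplicial G v S) D \<and> C \<subseteq> D"
    show "D = C"
    proof (cases "v \<in> D")
      case True
      then have "C \<subseteq> S" using D iff v[OF \<open>clique G C\<close>] by auto
      then have "C = S" using C G(3) by (auto simp: maximal_clique_def)
      then show ?thesis using C S by simp
    next
      case False
      then show ?thesis using D iff C by (auto simp: maximal_clique_def)
    qed
  qed
  have 3: "C = insert v S \<or> maximal_clique G C" if C: "maximal_clique (add_simplicial G v S) C"
  proof (cases "v \<in> C")
    case True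
    then have "C \<subseteq> insert v S" using C iff by (auto simp: maximal_clique_def)
    then show ?thesis using C 1 unfolding maximal_clique_def by blast
  next
    case False
    then show ?thesis using C v unfolding maximal_clique_def iff by auto
  qed
  show ?thesis using 1 2 3 by blast
qed

lemma rtranclp_adj_avoiding_add_simplicial:
  assumes G: "simple_ugraph G" "v \<notin> uverts G" "clique G S"
    and r: "(adj_avoiding (add_simplicial G v S) X)\<^sup>*\<^sup>* u w" and u: "u \<noteq> v" and w: "w \<noteq> v"
  shows "(adj_avoiding G X)\<^sup>*\<^sup>* u w"
proof -
  have vS: "v \<notin> S" using G(2,3) by (auto simp: clique_def)
  \<comment> \<open>A visit to \<open>v\<close> can be short-cut inside the clique \<open>S\<close>.\<close>
  have "(w \<noteq> v \<longrightarrow> (adj_avoiding G X)\<^sup>*\<^sup>* u w) \<and> (w = v \<longrightarrow> (\<forall>a\<in>S - X. (adj_avoiding G X)\<^sup>*\<^sup>* u a))"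
    using r
  proof (induction rule: rtranclp_induct)
    case base
    then show ?case using u by simp
  next
    case (step y z)
    have yz: "{y, z} \<in> uedges (add_simplicial G v S)" "y \<notin> X" "z \<notin> X"
      using step.hyps(2) by (auto simp: adj_avoiding_def)
    have "y \<noteq> z"
    proof
      assume "y = z"
      then show False using yz(1) G(1) vS by (auto simp: add_simplicial_def simple_ugraph_def)
    qed
    then consider "y \<noteq> v" "z \<noteq> v" "{y, z} \<in> uedges G" | "y = v" "z \<in> S" | "z = v" "y \<in> S"
      using yz edge_add_simplicial_iff[OF G(1,2) vS] by blast
    then show ?case
    proof cases
      case 1
      then show ?thesis using step.IH yz
        by (auto simp: adj_avoiding_def intro: rtranclp.rtrancl_into_rtrancl)
    next
      case 2
      then show ?thesis using step.IH yz vS by auto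
    next
      case 3
      have "(adj_avoiding G X)\<^sup>*\<^sup>* u a" if "a \<in> S - X" for a
      proof (cases "a = y")
        case True
        then show ?thesis using step.IH 3 vS by auto
      next
        case False
        then have "adj_avoiding G X y a"
          using that 3 G(3) yz by (auto simp: adj_avoiding_def clique_def)
        moreover have "(adj_avoiding G X)\<^sup>*\<^sup>* u y" using step.IH 3 vS by auto
        ultimately show ?thesis by (rule rtranclp.rtrancl_into_rtrancl[rotated])
      qed
      then show ?thesis using 3 by simp
    qed
  qed
  then show ?thesis using w by simp
qed

section \<open>Separation after attaching a vertex\<close>

lemma linked_add_simplicial_iff:
  assumes "simple_ugraph G" "v \<notin> uverts G" "clique G S" "v \<notin> Q" "v \<notin> Q'"
  shows "linked (add_simplicial G v S) Q Q' \<longleftrightarrow> linked G Q Q'"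
proof -
  have "uedges G \<subseteq> uedges (add_simplicial G v S)" by (auto simp: add_simplicial_def)
  then have "(adj_avoiding (add_simplicial G v S) (Q \<inter> Q'))\<^sup>*\<^sup>* a b \<longleftrightarrow>
      (adj_avoiding G (Q \<inter> Q'))\<^sup>*\<^sup>* a b" if "a \<in> Q - Q'" "b \<in> Q' - Q" for a b
    using rtranclp_adj_avoiding_add_simplicial[OF assms(1-3)] rtranclp_adj_avoiding_mono[OF _ _ order_refl]
      that assms(4,5) by (metis DiffD1)
  then show ?thesis unfolding linked_def by simp
qed

text \<open>The intersection of the two sets is \<open>S\<close>, whose removal isolates
  \<open>v\<close>, and \<open>v\<close> is the only vertex of \<open>insert v S\<close> outside
  \<open>Q\<close>.\<close>

lemma not_linked_add_simplicial:
  assumes G: "simple_ugraph G" "v \<notin> uverts G" "v \<notin> Q" and S: "S \<subseteq> Q"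
  shows "\<not> linked (add_simplicial G v S) Q (insert v S)"
proof
  let ?H = "add_simplicial G v S"
  have vS: "v \<notin> S" using G(3) S by auto
  have X: "Q \<inter> insert v S = S" using G(3) S by auto
  assume "linked ?H Q (insert v S)"
  then obtain u w where uw: "u \<in> Q - insert v S" "w \<in> insert v S - Q" "(adj_avoiding ?H S)\<^sup>*\<^sup>* u w"
    by (auto simp: linked_def X)
  then have "w = v" "u \<noteq> v" using S by auto
  then obtain y where y: "adj_avoiding ?H S y v" using uw(3) by (metis rtranclp.cases)
  \<comment> \<open>All neighbours of \<open>v\<close> lie in the avoided set \<open>S\<close>, so
    the last step into \<open>v\<close> would have to be a loop.\<close>
  then have "y = v" using edge_add_simplicial_iff[OF G(1,2) vS, of y v]
    by (auto simp: adj_avoiding_def)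
  then show False using y G(1) vS by (auto simp: adj_avoiding_def add_simplicial_def simple_ugraph_def)
qed

text \<open>The end of the walk in the new clique is some \<open>s\<close> in \<open>S - Q\<close>,
  not \<open>v\<close>. If \<open>Q \<inter> R\<close> is small, a walk linking \<open>Q\<close> to
  \<open>R\<close> is extended to \<open>s\<close> inside the clique \<open>R\<close>; otherwise the
  one vertex of \<open>R\<close> outside \<open>S\<close> lies in \<open>Q\<close> and is adjacent
  to \<open>s\<close>.\<close>

lemma linked_add_simplicial:
  assumes v: "v \<notin> R" "v \<notin> Q"
    and R: "clique G R" "S \<subseteq> R" "card R = Suc (card S)"
    and QR: "card (Q \<inter> R) < card S \<Longrightarrow> linked G Q R"
    and S: "\<not> S \<subseteq> Q"
  shows "linked (add_simplicial G v S) Q (insert v S)"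
proof -
  let ?H = "add_simplicial G v S"
  have X: "Q \<inter> insert v S = Q \<inter> S" using v by auto
  have finR: "finite R" using R(3) by (metis card.infinite nat.distinct(1))
  have sub: "uedges G \<subseteq> uedges ?H" by (auto simp: add_simplicial_def)
  obtain s where s: "s \<in> S" "s \<notin> Q" using S by blast
  show ?thesis
  proof (cases "card (Q \<inter> R) < card S")
    case True
    then obtain u w where uw: "u \<in> Q - R" "w \<in> R - Q" "(adj_avoiding G (Q \<inter> R))\<^sup>*\<^sup>* u w"
      using QR by (auto simp: linked_def)
    \<comment> \<open>Both \<open>w\<close> and \<open>s\<close> lie in the clique \<open>R\<close>
      and outside \<open>Q\<close>.\<close>
    have "(adj_avoiding G (Q \<inter> R))\<^sup>*\<^sup>* w s"
    proof (cases "w = s")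
      case False
      then have "adj_avoiding G (Q \<inter> R) w s"
        using uw s R by (auto simp: adj_avoiding_def clique_def)
      then show ?thesis by blast
    qed simp
    then have "(adj_avoiding G (Q \<inter> R))\<^sup>*\<^sup>* u s" using uw(3) by auto
    then have "(adj_avoiding ?H (Q \<inter> S))\<^sup>*\<^sup>* u s"
      using sub by (rule rtranclp_adj_avoiding_mono) (use R(2) in auto)
    moreover have "u \<in> Q - insert v S" "s \<in> insert v S - Q" using uw s v R(2) by auto
    ultimately show ?thesis unfolding linked_def X by (intro bexI)
  next
    case False
    \<comment> \<open>Then \<open>Q\<close> misses only \<open>s\<close> from \<open>R\<close>, so it contains the vertex \<open>r\<close> of \<open>R\<close> outside \<open>S\<close>.\<close>
    obtain r where r: "r \<in> R" "r \<notin> S" using R by (metis n_not_Suc_n subsetI subset_antisym)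
    have finS: "finite S" using R(2) finR by (rule finite_subset)
    have "r \<in> Q"
    proof (rule ccontr)
      assume "r \<notin> Q"
      have "card (insert r S) = card R" using r R(3) finS by simp
      then have "insert r S = R" using r R finR by (metis card_subset_eq insert_subset)
      then have "Q \<inter> R \<subseteq> S - {s}" using \<open>r \<notin> Q\<close> s by auto
      then have "card (Q \<inter> R) \<le> card (S - {s})" using finS by (intro card_mono) auto
      also have "\<dots> < card S" using finS s by (meson card_Diff1_less)
      finally show False using False by simp
    qed
    have "adj_avoiding ?H (Q \<inter> S) r s"
    proof -
      have "{r, s} \<in> uedges G" using r s R(1,2) unfolding clique_def by (metis subsetD)
      then show ?thesis using r s sub by (auto simp: adj_avoiding_def)
    qed
    then have "(adj_avoiding ?H (Q \<inter> S))\<^sup>*\<^sup>* r s" by (rule r_into_rtranclp)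
    moreover have "r \<in> Q - insert v S" "s \<in> insert v S - Q" using \<open>r \<in> Q\<close> r s v by auto
    ultimately show ?thesis unfolding linked_def X by (intro bexI)
  qed
qed

section \<open>Maximal cliques of \<open>k\<close>-trees\<close>

lemma k_tree_cliques:
  assumes "k_tree k G"
  shows "(\<forall>Q. maximal_clique G Q \<longrightarrow> card Q = Suc k) \<and>
    (\<forall>C. clique G C \<longrightarrow> (\<exists>Q. maximal_clique G Q \<and> C \<subseteq> Q)) \<and>
    (\<forall>Q Q'. maximal_clique G Q \<longrightarrow> maximal_clique G Q' \<longrightarrow> Q \<noteq> Q' \<longrightarrow> Q \<inter> Q' \<noteq> {} \<longrightarrow>
       (\<not> linked G Q Q' \<longleftrightarrow> card (Q \<inter> Q') = k)) \<and>
    (\<exists>T. utree T \<and> uverts T = {Q. maximal_clique G Q} \<and> (\<forall>e\<in>uedges T. card (\<Inter>e) = k))"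
  using assms
proof (induction rule: k_tree.induct)
  case (complete V)
  let ?K = "\<lparr>uverts = V, uedges = {e. e \<subseteq> V \<and> card e = 2}\<rparr>"
  have cl: "clique ?K C \<longleftrightarrow> C \<subseteq> V" for C by (auto simp: clique_def)
  then have mc: "maximal_clique ?K C \<longleftrightarrow> C = V" for C by (auto simp: maximal_clique_def)
  have "\<exists>T. utree T \<and> uverts T = {V} \<and> (\<forall>e\<in>uedges T. card (\<Inter>e) = k)"
    using utree_singleton[of V] by (intro exI[of _ "\<lparr>uverts = {V}, uedges = {}\<rparr>"]) simp
  then show ?case using complete by (simp add: cl mc)
next
  case (add_vertex G v S)
  note simple = k_tree_simple_ugraph[OF add_vertex.hyps(1)]
  note G = simple add_vertex.hyps(2,3)
  let ?H = "add_simplicial G v S"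
  have cardQ: "\<And>Q. maximal_clique G Q \<Longrightarrow> card Q = Suc k"
    and ext: "\<And>C. clique G C \<Longrightarrow> \<exists>Q. maximal_clique G Q \<and> C \<subseteq> Q"
    and sep: "\<And>Q Q'. maximal_clique G Q \<Longrightarrow> maximal_clique G Q' \<Longrightarrow> Q \<noteq> Q' \<Longrightarrow> Q \<inter> Q' \<noteq> {} \<Longrightarrow>
       \<not> linked G Q Q' \<longleftrightarrow> card (Q \<inter> Q') = k"
    using add_vertex.IH by simp_all
  have finV: "finite (uverts G)" using simple by (simp add: simple_ugraph_def)
  have mc: "clique G Q" "v \<notin> Q" if "maximal_clique G Q" for Q
    using that add_vertex.hyps(2) by (auto simp: maximal_clique_def clique_def)
  have vS: "v \<notin> S" and finS: "finite S" using G(2,3) finite_subset[OF _ finV]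
    by (auto simp: clique_def)
  \<comment> \<open>\<open>S\<close> has only \<open>k\<close> vertices, one fewer than every
    maximal clique of \<open>G\<close>.\<close>
  have max_iff: "maximal_clique ?H C \<longleftrightarrow> C = insert v S \<or> maximal_clique G C" for C
    using maximal_clique_add_simplicial_iff[OF G] cardQ[of S] add_vertex.hyps(4) by auto
  obtain R where R: "maximal_clique G R" "S \<subseteq> R" using ext G(3) by blast
  have new: "\<not> linked ?H Q (insert v S) \<longleftrightarrow> card (Q \<inter> insert v S) = k"
    if Q: "maximal_clique G Q" and ne: "Q \<inter> insert v S \<noteq> {}" for Q
  proof -
    have "Q \<inter> insert v S = Q \<inter> S" using mc(2)[OF Q] by auto
    moreover have "card (Q \<inter> S) = k \<longleftrightarrow> S \<subseteq> Q"
      using add_vertex.hyps(4) finS card_subset_eq[of S "Q \<inter> S"] by (auto simp: Int_absorb1)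
    moreover have "\<not> linked ?H Q (insert v S)" if "S \<subseteq> Q"
      using not_linked_add_simplicial[OF G(1,2) mc(2)[OF Q] that] .
    moreover have "linked ?H Q (insert v S)" if "\<not> S \<subseteq> Q"
    proof (rule linked_add_simplicial[OF mc(2)[OF R(1)] mc(2)[OF Q] mc(1)[OF R(1)] R(2) _ _ that])
      show "card R = Suc (card S)" using cardQ[OF R(1)] add_vertex.hyps(4) by simp
      \<comment> \<open>\<open>R\<close> contains \<open>S\<close> but \<open>Q\<close> does not,
        and \<open>Q\<close> meets \<open>S\<close>; hence the induction hypothesis applies to this
        pair.\<close>
      have "Q \<noteq> R" "Q \<inter> R \<noteq> {}" using that R(2) ne mc(2)[OF Q] by auto
      then show "linked G Q R" if "card (Q \<inter> R) < card S"
        using sep[OF Q R(1)] that add_vertex.hyps(4) by auto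
    qed
    ultimately show ?thesis by auto
  qed
  have "card Q = Suc k" if "maximal_clique ?H Q" for Q
    using that cardQ vS finS add_vertex.hyps(4) by (auto simp: max_iff)
  moreover have "\<exists>Q. maximal_clique ?H Q \<and> C \<subseteq> Q" if "clique ?H C" for C
    using that ext unfolding clique_add_simplicial_iff[OF G] max_iff by (metis (full_types))
  moreover have "\<not> linked ?H Q Q' \<longleftrightarrow> card (Q \<inter> Q') = k"
    if Q: "maximal_clique ?H Q" "maximal_clique ?H Q'" and ne: "Q \<noteq> Q'" "Q \<inter> Q' \<noteq> {}" for Q Q'
  proof -
    consider "maximal_clique G Q" "maximal_clique G Q'" | "maximal_clique G Q" "Q' = insert v S"
      | "maximal_clique G Q'" "Q = insert v S"
      using Q ne(1) unfolding max_iff by auto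
    then show ?thesis
    proof cases
      case 1
      then show ?thesis using linked_add_simplicial_iff[OF G] mc(2) sep[OF _ _ ne] by simp
    next
      case 2
      then show ?thesis using new ne(2) by simp
    next
      case 3
      then show ?thesis using new[of Q'] ne(2) linked_sym[of ?H Q Q'] by (simp add: Int_commute)
    qed
  qed
  moreover have "\<exists>T. utree T \<and> uverts T = {Q. maximal_clique ?H Q} \<and> (\<forall>e\<in>uedges T. card (\<Inter>e) = k)"
  proof -
    obtain T where T: "utree T" "uverts T = {Q. maximal_clique G Q}" "\<forall>e\<in>uedges T. card (\<Inter>e) = k"
      using add_vertex.IH by (elim conjE exE)
    have "insert v S \<notin> uverts T" using T(2) mc(2) by blast
    then have "utree \<lparr>uverts = insert (insert v S) (uverts T),
        uedges = insert {insert v S, R} (uedges T)\<rparr>"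
      using T(1,2) R(1) by (intro utree_add_leaf) auto
    \<comment> \<open>So the new tree edge has weight \<open>card S = k\<close>.\<close>
    moreover have "insert v S \<inter> R = S" using R mc(2) by auto
    ultimately show ?thesis
      using T(2,3) add_vertex.hyps(4)
      by (intro exI[of _ "\<lparr>uverts = insert (insert v S) (uverts T),
        uedges = insert {insert v S, R} (uedges T)\<rparr>"]) (auto simp: max_iff)
  qed
  ultimately show ?case unfolding add_simplicial_def by (intro conjI allI impI)
qed

section \<open>Clique trees and spanning trees of the reduced clique graph\<close>

theorem theorem11:
  fixes G :: "'a ugraph" and k :: nat
  assumes "k_tree k G"
  shows "card {T. clique_tree G T} = card {T. uspanning_tree (reduced_clique_graph G) T}"
proof -
  let ?H = "clique_intersection_graph G" and ?R = "reduced_clique_graph G"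
  have cardQ: "\<And>Q. maximal_clique G Q \<Longrightarrow> card Q = Suc k"
    and sep: "\<And>Q Q'. maximal_clique G Q \<Longrightarrow> maximal_clique G Q' \<Longrightarrow> Q \<noteq> Q' \<Longrightarrow> Q \<inter> Q' \<noteq> {} \<Longrightarrow>
       \<not> linked G Q Q' \<longleftrightarrow> card (Q \<inter> Q') = k"
    using k_tree_cliques[OF assms] by simp_all
  obtain T\<^sub>0 where T\<^sub>0: "utree T\<^sub>0" "uverts T\<^sub>0 = {Q. maximal_clique G Q}"
      "\<forall>e\<in>uedges T\<^sub>0. card (\<Inter>e) = k"
    using k_tree_cliques[OF assms] by (elim conjE exE)
  have verts: "uverts ?H = {Q. maximal_clique G Q}" "uverts ?R = {Q. maximal_clique G Q}"
    by (simp_all add: clique_intersection_graph_def reduced_clique_graph_def)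
  have edges_R: "uedges ?R = {e \<in> uedges ?H. card (\<Inter>e) = k}"
  proof -
    have "separating_pair G Q Q' \<longleftrightarrow>
        maximal_clique G Q \<and> maximal_clique G Q' \<and> Q \<inter> Q' \<noteq> {} \<and> card (Q \<inter> Q') = k"
      if "Q \<noteq> Q'" for Q Q'
      using separating_pair_iff_not_linked[OF k_tree_simple_ugraph[OF assms]] sep that
      by (metis separating_pair_def)
    then have "uedges ?R = {{Q, Q'} | Q Q'. maximal_clique G Q \<and> maximal_clique G Q' \<and> Q \<noteq> Q' \<and>
        Q \<inter> Q' \<noteq> {} \<and> card (Q \<inter> Q') = k}"
      unfolding reduced_clique_graph_def ugraph.simps by (intro Collect_cong) metis
    also have "\<dots> = {e \<in> uedges ?H. card (\<Inter>e) = k}"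
      unfolding clique_intersection_graph_def ugraph.simps
      by (intro equalityI subsetI; clarsimp; blast)
    finally show ?thesis .
  qed
  have weight_le: "card (\<Inter>e) \<le> k" if edge: "e \<in> uedges ?H" for e
  proof -
    obtain Q Q' where e: "e = {Q, Q'}" "maximal_clique G Q" "maximal_clique G Q'" "Q \<noteq> Q'"
      using edge by (auto simp: clique_intersection_graph_def)
    have fin: "finite Q" "finite Q'" using cardQ e by (metis card.infinite nat.distinct(1))+
    \<comment> \<open>Containment between sets of equal size would force equality.\<close>
    have "Q \<inter> Q' \<noteq> Q" using card_subset_eq[of Q' Q] fin cardQ e by auto
    then have "card (Q \<inter> Q') < card Q" using fin by (intro psubset_card_mono) auto
    then show ?thesis using cardQ e by simp
  qed
  \<comment> \<open>The largest conceivable weight: every edge has the maximal weight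
    \<open>k\<close>. Only the number of edges of \<open>T\<^sub>0\<close> enters here; it need not
    be a spanning tree of \<open>?H\<close>.\<close>
  define m where "m = k * card (uedges T\<^sub>0)"
  have card_edges: "card (uedges T) = card (uedges T\<^sub>0)" if "uspanning_tree ?H T" for T
    using that T\<^sub>0 card_uedges_utree verts unfolding uspanning_tree_def by (metis nat.inject)
  have sum_k: "(\<Sum>e\<in>uedges T. k) = m" if "uspanning_tree ?H T" for T
    using card_edges[OF that] by (simp add: m_def mult.commute)
  have weight_le_m: "clique_weight T \<le> m" if "uspanning_tree ?H T" for T
    unfolding sum_k[OF that, symmetric] clique_weight_def
    using that weight_le by (intro sum_mono) (auto simp: uspanning_tree_def)
  have weight_eq: "clique_weight T = m \<longleftrightarrow> (\<forall>e\<in>uedges T. card (\<Inter>e) = k)"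
    if T: "uspanning_tree ?H T" for T
  proof
    have fin: "finite (uedges T)" using T finite_uedges by (auto simp: uspanning_tree_def utree_def)
    assume "clique_weight T = m"
    then have "(\<Sum>e\<in>uedges T. card (\<Inter>e)) = (\<Sum>e\<in>uedges T. k)"
      using sum_k[OF T] by (simp add: clique_weight_def)
    then show "\<forall>e\<in>uedges T. card (\<Inter>e) = k"
      \<comment> \<open>A sum of terms at most \<open>k\<close> equals the sum of the bounds only if
        every term equals \<open>k\<close>.\<close>
      using sum_mono_inv[of "\<lambda>e. card (\<Inter>e)" "uedges T" "\<lambda>_. k"] weight_le T fin
      by (auto simp: uspanning_tree_def)
  next
    assume "\<forall>e\<in>uedges T. card (\<Inter>e) = k"
    then show "clique_weight T = m" using sum_k[OF T] by (simp add: clique_weight_def)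
  qed
  have R_iff: "uspanning_tree ?R T \<longleftrightarrow> uspanning_tree ?H T \<and> clique_weight T = m" for T
  proof -
    have "uspanning_tree ?R T \<longleftrightarrow> uspanning_tree ?H T \<and> (\<forall>e\<in>uedges T. card (\<Inter>e) = k)"
      using verts by (auto simp: uspanning_tree_def edges_R)
    then show ?thesis using weight_eq by auto
  qed
  \<comment> \<open>The assumption that some spanning tree exists matters for \<open>k = 0\<close>,
    when \<open>?H\<close> has no edges and may be disconnected. If one exists then, its weight is
    \<open>m = 0\<close>; for \<open>k > 0\<close> the tree \<open>T\<^sub>0\<close> itself attains
    \<open>m\<close>.\<close>
  have max_attained: "\<exists>T'. uspanning_tree ?H T' \<and> clique_weight T' = m" if "uspanning_tree ?H T" for T
  proof (cases "k = 0")
    case True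
    then show ?thesis using that weight_le_m[OF that] by (auto simp: m_def)
  next
    case False
    have "e \<in> uedges ?H" if e: "e \<in> uedges T\<^sub>0" for e
    proof -
      have "e \<subseteq> uverts T\<^sub>0" "card e = 2" using T\<^sub>0(1) e by (auto simp: utree_def simple_ugraph_def)
      then obtain Q Q' where QQ': "e = {Q, Q'}" "Q \<noteq> Q'" "maximal_clique G Q" "maximal_clique G Q'"
        using T\<^sub>0(2) by (auto simp: card_2_iff)
      \<comment> \<open>Positive weight means that the two cliques meet, so \<open>e\<close> is an
        edge of \<open>?H\<close>.\<close>
      have "card (Q \<inter> Q') \<noteq> 0" using T\<^sub>0(3) e QQ'(1) False by auto
      then have "Q \<inter> Q' \<noteq> {}" by auto
      with QQ' show ?thesis unfolding clique_intersection_graph_def ugraph.simps by blast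
    qed
    then have "uspanning_tree ?H T\<^sub>0" using T\<^sub>0 verts by (auto simp: uspanning_tree_def)
    then show ?thesis using weight_eq T\<^sub>0(3) by blast
  qed
  \<comment> \<open>As \<open>m\<close> is both an upper bound and attained, maximal weight means
    weight \<open>m\<close>; even the two sets of trees coincide.\<close>
  have "clique_tree G T \<longleftrightarrow> uspanning_tree ?R T" for T
    unfolding clique_tree_def R_iff using weight_le_m max_attained by (metis order_antisym)
  then show ?thesis by simp
qed

end
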